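(* Let $\frac23<\nu<\frac45$. Then there exist real numbers $\nu_-,\nu_+$ satisfying (i) $\nu_->0$ and $\nu_+>0$; (ii) $\nu_-\in\left(\frac32\nu-1,\frac12\nu\right)$; (iii) $\nu_+\in(0,1-\nu)$; (iv) $1-\nu=\nu_-+\nu_+$. For every such choice of $\nu_-,\nu_+$, the functions $S_{kl}=S^{\mathrm{SG}}_{kl}\,S^{\mathrm{CDD}}_{kl}$, $k,l\in\{1,2\}$ (defined in the context), satisfy the following properties, for all $k,l\in\{1,2\}$ (functional equations are identities of meromorphic functions of $\zeta\in\mathbb{C}$): (S1) $S_{kl}$ is meromorphic on $\mathbb{C}$. (S2) $S_{kl}(\zeta)=S_{lk}(\zeta)$. (S3) $S_{kl}(\zeta)^{-1}=\overline{S_{lk}(\bar\zeta)}$. (S4) $S_{kl}(\zeta)=S_{kl}(-\zeta)^{-1}$. (S5) $S_{kl}(i\pi-\zeta)=S_{lk}(\zeta)$. (S6) (Bootstrap) For each fusion process $(\alpha\beta)\to\gamma$ among $(11)\to 2$, $(12)\to 1$, $(21)\to 1$, and each $\mu\in\{1,2\}$, $$S_{\gamma\mu}(\zeta)=S_{\alpha\mu}\left(\zeta+i\theta^{\gamma}_{(\alpha\beta)}\right)S_{\beta\mu}\left(\zeta-i\theta^{\gamma}_{(\beta\alpha)}\right).$$ (S7) $S_{kk}(0)=-1$. (S8) $S_{kl}$ has only finitely many zeros in the strip $0<\operatorname{Im}\zeta<\pi$, and there is $\kappa>0$ such that $\sup\{|S_{kl}(\zeta)|:\zeta\in\mathbb{R}+i(-\kappa,\kappa)\}<\infty$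 for all $k,l$. (S9) In the strip $0<\operatorname{Im}\zeta<\pi$, the function $S_{11}$ has exactly two poles, both simple, located at $i\pi\nu$ and $i\pi(1-\nu)$; and $S_{12}$ has exactly two poles, both simple, located at $i\pi\left(1-\frac{\nu}{2}\right)$ and $\frac{i\pi\nu}{2}$. (S10) $\operatorname{Res}_{\zeta=i\pi\nu}S_{11}(\zeta)\in i\mathbb{R}_+$ and $\operatorname{Res}_{\zeta=i\pi(1-\nu/2)}S_{12}(\zeta)\in i\mathbb{R}_+$, where $\mathbb{R}_+=(0,\infty)$.
   Context: The indices $1,2$ label two particle species (breathers $b_1,b_2$), and $S_{kl}$ denotes the S-matrix component $S^{b_lb_k}_{b_kb_l}$. Sine-Gordon breather-breather components: $$S^{\mathrm{SG}}_{11}(\zeta)=\frac{\tan\frac{1}{2i}(\zeta+i\pi\nu)}{\tan\frac1{2i}(\zeta-i\pi\nu)},\qquad S^{\mathrm{SG}}_{12}(\zeta)=S^{\mathrm{SG}}_{21}(\zeta)=\frac{\tan\frac{1}{2i}\left(\zeta+\frac{3i\pi\nu}{2}\right)}{\tan\frac1{2i}\left(\zeta-\frac{3i\pi\nu}2\right)}\cdot\frac{\tan\frac{1}{2i}\left(\zeta+\frac{i\pi\nu}2\right)}{\tan\frac1{2i}\left(\zeta-\frac{i\pi\nu}2\right)},$$ $$S^{\mathrm{SG}}_{22}(\zeta)=\frac{\tan\frac{1}{2i}(\zeta+2i\pi\nu)}{\tan\frac1{2i}(\zeta-2i\pi\nu)}\cdot\frac{\left(\tan\frac{1}{2i}(\zeta+i\pi\nu)\right)^2}{\left(\tan\frac1{2i}(\zeta-i\pi\nu)\right)^2}.$$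 CDD factors: for real $a$ put $h_a(\zeta)=\dfrac{\sinh\frac12(\zeta-i\pi a)}{\sinh\frac12(\zeta+i\pi a)}$. Then $$S^{\mathrm{CDD}}_{11}(\zeta)=h_{\nu-\nu_-}(\zeta)\,h_{\nu+\nu_+}(\zeta)\,h_{1-\nu+\nu_-}(\zeta)\,h_{1-\nu-\nu_+}(\zeta),$$ $$S^{\mathrm{CDD}}_{12}(\zeta)=S^{\mathrm{CDD}}_{21}(\zeta)=S^{\mathrm{CDD}}_{11}\left(\zeta+\tfrac{i\pi\nu}{2}\right)S^{\mathrm{CDD}}_{11}\left(\zeta-\tfrac{i\pi\nu}{2}\right),$$ $$S^{\mathrm{CDD}}_{22}(\zeta)=S^{\mathrm{CDD}}_{12}\left(\zeta+\tfrac{i\pi\nu}{2}\right)S^{\mathrm{CDD}}_{12}\left(\zeta-\tfrac{i\pi\nu}{2}\right).$$ Fusion rapidities: $\theta^{2}_{(11)}=\frac{\pi\nu}{2}$, $\theta^{1}_{(12)}=\pi(1-\nu)$, $\theta^{1}_{(21)}=\frac{\pi\nu}{2}$. *)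

theory Defs
  imports "HOL-Complex_Analysis.Complex_Analysis"
begin

datatype breather = b1 | b2

definition tan_factor :: "real \<Rightarrow> complex \<Rightarrow> complex" where
  "tan_factor a \<zeta> =
     tan (1 / (2 * \<i>) * (\<zeta> + \<i> * of_real (pi * a))) / tan (1 / (2 * \<i>) * (\<zeta> - \<i> * of_real (pi * a)))"

fun S_SG :: "real \<Rightarrow> breather \<Rightarrow> breather \<Rightarrow> complex \<Rightarrow> complex" where
  "S_SG \<nu> b1 b1 \<zeta> = tan_factor \<nu> \<zeta>"
| "S_SG \<nu> b1 b2 \<zeta> = tan_factor (3 * \<nu> / 2) \<zeta> * tan_factor (\<nu> / 2) \<zeta>"
| "S_SG \<nu> b2 b1 \<zeta> = tan_factor (3 * \<nu> / 2) \<zeta> * tan_factor (\<nu> / 2) \<zeta>"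
| "S_SG \<nu> b2 b2 \<zeta> = tan_factor (2 * \<nu>) \<zeta> * (tan_factor \<nu> \<zeta>)\<^sup>2"

definition h_factor :: "real \<Rightarrow> complex \<Rightarrow> complex" where
  "h_factor a \<zeta> =
     sinh (1 / 2 * (\<zeta> - \<i> * of_real (pi * a))) / sinh (1 / 2 * (\<zeta> + \<i> * of_real (pi * a)))"

definition CDD11 :: "real \<Rightarrow> real \<Rightarrow> real \<Rightarrow> complex \<Rightarrow> complex" where
  "CDD11 \<nu> \<nu>m \<nu>p \<zeta> =
     h_factor (\<nu> - \<nu>m) \<zeta> * h_factor (\<nu> + \<nu>p) \<zeta> * h_factor (1 - \<nu> + \<nu>m) \<zeta> * h_factor (1 - \<nu> - \<nu>p) \<zeta>"

definition CDD12 :: "real \<Rightarrow> real \<Rightarrow> real \<Rightarrow> complex \<Rightarrow> complex" where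
  "CDD12 \<nu> \<nu>m \<nu>p \<zeta> =
     CDD11 \<nu> \<nu>m \<nu>p (\<zeta> + \<i> * of_real (pi * \<nu> / 2)) * CDD11 \<nu> \<nu>m \<nu>p (\<zeta> - \<i> * of_real (pi * \<nu> / 2))"

definition CDD22 :: "real \<Rightarrow> real \<Rightarrow> real \<Rightarrow> complex \<Rightarrow> complex" where
  "CDD22 \<nu> \<nu>m \<nu>p \<zeta> =
     CDD12 \<nu> \<nu>m \<nu>p (\<zeta> + \<i> * of_real (pi * \<nu> / 2)) * CDD12 \<nu> \<nu>m \<nu>p (\<zeta> - \<i> * of_real (pi * \<nu> / 2))"

fun S_CDD :: "real \<Rightarrow> real \<Rightarrow> real \<Rightarrow> breather \<Rightarrow> breather \<Rightarrow> complex \<Rightarrow> complex" where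
  "S_CDD \<nu> \<nu>m \<nu>p b1 b1 \<zeta> = CDD11 \<nu> \<nu>m \<nu>p \<zeta>"
| "S_CDD \<nu> \<nu>m \<nu>p b1 b2 \<zeta> = CDD12 \<nu> \<nu>m \<nu>p \<zeta>"
| "S_CDD \<nu> \<nu>m \<nu>p b2 b1 \<zeta> = CDD12 \<nu> \<nu>m \<nu>p \<zeta>"
| "S_CDD \<nu> \<nu>m \<nu>p b2 b2 \<zeta> = CDD22 \<nu> \<nu>m \<nu>p \<zeta>"

(* The formulas above use x / 0 = 0 at isolated points, where the product may have a removable
   singularity. remove_sings selects the meromorphic function they define: its value is the limit
   at every point where that exists, and 0 at poles. *)
definition S_mat :: "real \<Rightarrow> real \<Rightarrow> real \<Rightarrow> breather \<Rightarrow> breather \<Rightarrow> complex \<Rightarrow> complex" where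
  "S_mat \<nu> \<nu>m \<nu>p k l = remove_sings (\<lambda>\<zeta>. S_SG \<nu> k l \<zeta> * S_CDD \<nu> \<nu>m \<nu>p k l \<zeta>)"

definition admissible :: "real \<Rightarrow> real \<Rightarrow> real \<Rightarrow> bool" where
  "admissible \<nu> \<nu>m \<nu>p \<longleftrightarrow>
     \<nu>m > 0 \<and> \<nu>p > 0 \<and> \<nu>m \<in> {3 / 2 * \<nu> - 1 <..< 1 / 2 * \<nu>} \<and> \<nu>p \<in> {0 <..< 1 - \<nu>} \<and>
     1 - \<nu> = \<nu>m + \<nu>p"

(* (\<alpha>, \<beta>, \<gamma>) stands for the process (\<alpha> \<beta>) \<rightarrow> \<gamma>. *)
definition fusions :: "(breather \<times> breather \<times> breather) set" where
  "fusions = {(b1, b1, b2), (b1, b2, b1), (b2, b1, b1)}"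

(* fusion_angle \<nu> \<gamma> \<alpha> \<beta> is the angle with upper index \<gamma> and lower index (\<alpha> \<beta>);
   it is left unspecified when (\<alpha> \<beta>) \<rightarrow> \<gamma> is not a fusion process. *)
fun fusion_angle :: "real \<Rightarrow> breather \<Rightarrow> breather \<Rightarrow> breather \<Rightarrow> real" where
  "fusion_angle \<nu> b2 b1 b1 = pi * \<nu> / 2"
| "fusion_angle \<nu> b1 b1 b2 = pi * (1 - \<nu>)"
| "fusion_angle \<nu> b1 b2 b1 = pi * \<nu> / 2"

definition strip_poles :: "(complex \<Rightarrow> complex) \<Rightarrow> complex set" where
  "strip_poles f = {\<zeta>. 0 < Im \<zeta> \<and> Im \<zeta> < pi \<and> is_pole f \<zeta>}"

(* Poles are excluded because remove_sings assigns them the value 0. *)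
definition strip_zeros :: "(complex \<Rightarrow> complex) \<Rightarrow> complex set" where
  "strip_zeros f = {\<zeta>. 0 < Im \<zeta> \<and> Im \<zeta> < pi \<and> \<not> is_pole f \<zeta> \<and> f \<zeta> = 0}"

end

(* As a function of sinh \<zeta>, tan_factor a is the Moebius transformation
   (sinh \<zeta> + i sin(pi a)) / (sinh \<zeta> - i sin(pi a)), and h_factor a * h_factor (1 - a) is
   - 1 / tan_factor a. So each S_kl is a finite product of tan_factors. Unitarity, crossing
   and hermitian analyticity hold factor by factor, because the factor becomes its inverse under
   \<zeta> \<mapsto> - \<zeta> and under conjugation and depends on sinh \<zeta> only. The fusion (11) \<rightarrow> 2 follows from
   tan_factor a (\<zeta> + i pi c) * tan_factor a (\<zeta> - i pi c) = tan_factor (a + c) \<zeta> * tan_factor (a - c) \<zeta>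
   and tan_factor (- a) = 1 / tan_factor a; the fusions (12) \<rightarrow> 1 and (21) \<rightarrow> 1 follow from it by
   shifting \<zeta> and using S(\<zeta> + i pi) = 1 / S(\<zeta>). In the strip 0 < Im \<zeta> < pi a factor has a pole
   only if sin(pi a) > 0, and in the reduced products for S_11 and S_12 exactly one factor does.
   The residue is then a product of real ratios, whose signs come from comparing sines. *)
theory Submission
  imports Defs
begin

subsection \<open>The elementary factors\<close>

lemma tan_factor_tanh:
  "tan_factor a \<zeta> = tanh ((\<zeta> + \<i> * of_real (pi * a)) / 2) / tanh ((\<zeta> - \<i> * of_real (pi * a)) / 2)"
proof -
  have "tan (1 / (2 * \<i>) * z) = - \<i> * tanh (z / 2)" for z
    by (simp add: tan_conv_tanh tanh_minus)
  then show ?thesis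
    by (simp add: tan_factor_def)
qed

lemma tan_factor_minus: "tan_factor (- a) \<zeta> = inverse (tan_factor a \<zeta>)"
  by (simp add: tan_factor_tanh)

lemma sinh_i_times: "sinh (\<i> * of_real t) = \<i> * of_real (sin t)"
  by (simp add: sinh_conv_sin flip: mult.assoc sin_of_real)

lemma cosh_i_times: "cosh (\<i> * of_real t) = of_real (cos t)"
  by (simp add: cosh_conv_cos flip: mult.assoc cos_of_real)

lemma sinh_ipi_half: "sinh (x + \<i> * of_real pi / 2) = \<i> * cosh (x::complex)"
  "sinh (x - \<i> * of_real pi / 2) = - \<i> * cosh (x::complex)"
  using sinh_i_times[of "pi / 2"] cosh_i_times[of "pi / 2"] by (simp_all add: sinh_add sinh_diff)

text \<open>With \<open>x / 0 = 0\<close> this and the next identities between factors hold at every point, also at the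
  poles, so that exceptional points only arise from cancelling \<open>tan_factor a * tan_factor (- a)\<close>.\<close>

lemma tan_factor_sinh:
  "tan_factor a \<zeta> = (sinh \<zeta> + \<i> * of_real (sin (pi * a))) / (sinh \<zeta> - \<i> * of_real (sin (pi * a)))"
proof -
  define x y where "x = (\<zeta> + \<i> * of_real (pi * a)) / 2" and "y = (\<zeta> - \<i> * of_real (pi * a)) / 2"
  have xy: "\<zeta> = x + y" "\<i> * of_real (pi * a) = x - y"
    by (simp_all add: x_def y_def field_simps)
  have s: "\<i> * of_real (sin (pi * a)) = sinh (x - y)"
    by (simp only: sinh_i_times flip: xy(2))
  have "tan_factor a \<zeta> = (2 * sinh x * cosh y) / (2 * cosh x * sinh y)"
    unfolding tan_factor_tanh x_def[symmetric] y_def[symmetric] by (simp add: tanh_def)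
  also have "2 * sinh x * cosh y = sinh \<zeta> + \<i> * of_real (sin (pi * a))"
    unfolding s xy(1) by (simp add: sinh_add sinh_diff)
  also have "2 * cosh x * sinh y = sinh \<zeta> - \<i> * of_real (sin (pi * a))"
    unfolding s xy(1) by (simp add: sinh_add sinh_diff)
  finally show ?thesis .
qed

lemma tan_factor_reflect: "tan_factor (1 - a) \<zeta> = tan_factor a \<zeta>"
  by (simp add: tan_factor_sinh sin_diff right_diff_distrib)

text \<open>The half arguments for 1 - a are those for a, exchanged and shifted by
  \<open>\<i> * of_real pi / 2\<close> up to sign. The shift turns \<open>sinh\<close> into
  \<open>cosh\<close>, so the two quotients combine into a quotient of \<open>tanh\<close>
  values.\<close>

lemma h_factor_pair: "h_factor a \<zeta> * h_factor (1 - a) \<zeta> = - tan_factor (- a) \<zeta>"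
proof -
  define x y where "x = (\<zeta> + \<i> * of_real (pi * a)) / 2" and "y = (\<zeta> - \<i> * of_real (pi * a)) / 2"
  have *: "1 / 2 * (\<zeta> - \<i> * of_real (pi * (1 - a))) = x - \<i> * of_real pi / 2"
    "1 / 2 * (\<zeta> + \<i> * of_real (pi * (1 - a))) = y + \<i> * of_real pi / 2"
    by (simp_all add: x_def y_def field_simps)
  have "h_factor (1 - a) \<zeta> = - cosh x / cosh y"
    unfolding h_factor_def * sinh_ipi_half by simp
  moreover have "h_factor a \<zeta> = sinh y / sinh x"
    by (simp add: h_factor_def x_def y_def)
  moreover have "tan_factor (- a) \<zeta> = tanh y / tanh x"
    by (simp add: tan_factor_tanh x_def y_def)
  ultimately show ?thesis
    by (simp add: tanh_def)
qed

text \<open>In terms of \<open>tanh\<close>, both sides have the same two numerators and the same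
  two denominators; only the denominators change partners. A shift of the argument thus becomes a
  shift of the parameter.\<close>

lemma tan_factor_shift:
  "tan_factor a (\<zeta> + \<i> * of_real (pi * c)) * tan_factor a (\<zeta> - \<i> * of_real (pi * c)) =
   tan_factor (a + c) \<zeta> * tan_factor (a - c) \<zeta>"
proof -
  have *: "\<zeta> + \<i> * of_real (pi * c) + \<i> * of_real (pi * a) = \<zeta> + \<i> * of_real (pi * (a + c))"
    "\<zeta> + \<i> * of_real (pi * c) - \<i> * of_real (pi * a) = \<zeta> - \<i> * of_real (pi * (a - c))"
    "\<zeta> - \<i> * of_real (pi * c) + \<i> * of_real (pi * a) = \<zeta> + \<i> * of_real (pi * (a - c))"
    "\<zeta> - \<i> * of_real (pi * c) - \<i> * of_real (pi * a) = \<zeta> - \<i> * of_real (pi * (a + c))"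
    by (simp_all add: algebra_simps)
  show ?thesis
    unfolding tan_factor_tanh * by simp
qed

text \<open>\<open>sinh\<close> is entire and not constant, so it takes each value on a sparse set
  only. This disposes of the points where a cancelled factor vanishes or has a pole.\<close>

lemma sinh_neq_cosparse: "\<forall>\<^sub>\<approx>\<zeta>\<in>UNIV. sinh (\<zeta>::complex) \<noteq> c"
proof -
  have "(\<lambda>\<zeta>::complex. sinh \<zeta>) analytic_on UNIV"
    by (intro analytic_intros)
  then have "(\<lambda>\<zeta>::complex. sinh \<zeta>) nicely_meromorphic_on UNIV"
    by (rule analytic_on_imp_nicely_meromorphic_on)
  from nicely_meromorphic_imp_constant_or_avoid[OF this open_UNIV connected_UNIV, of c]
  show ?thesis
  proof
    assume "\<forall>\<zeta>\<in>UNIV. sinh (\<zeta>::complex) = c"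
    \<comment> \<open>The actual values at these two points are \<i> and 0.\<close>
    then have "sinh (\<i> * of_real (pi / 2)) = sinh (0::complex)"
      by (metis UNIV_I)
    then show ?thesis
      unfolding sinh_i_times by simp
  qed
qed

subsection \<open>Identities of meromorphic functions\<close>

text \<open>Cosparse on \<open>UNIV\<close> means eventually along \<open>at x\<close> for every
  \<open>x\<close>, and translations carry punctured neighbourhoods to punctured neighbourhoods.
  Identities between shifted functions rest on this.\<close>

lemma eventually_cosparse_shift:
  fixes P :: "'a::real_normed_vector \<Rightarrow> bool"
  assumes "\<forall>\<^sub>\<approx>x\<in>UNIV. P x"
  shows "\<forall>\<^sub>\<approx>x\<in>UNIV. P (x + d)"
proof -
  have "eventually P (filtermap (\<lambda>x. x - (- d)) (at x))" for x
    using assms unfolding filtermap_at_shift by (simp add: eventually_cosparse_open_eq)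
  then show ?thesis
    by (simp add: eventually_cosparse_open_eq eventually_filtermap)
qed

lemma eventually_cosparse_minus:
  fixes P :: "'a::real_normed_vector \<Rightarrow> bool"
  assumes "\<forall>\<^sub>\<approx>x\<in>UNIV. P x"
  shows "\<forall>\<^sub>\<approx>x\<in>UNIV. P (- x)"
proof -
  have "eventually P (filtermap uminus (at x))" for x
    using assms unfolding filtermap_at_minus by (simp add: eventually_cosparse_open_eq)
  then show ?thesis
    by (simp add: eventually_cosparse_open_eq eventually_filtermap)
qed

text \<open>Conjugation is continuous and injective, so it sends \<open>at x\<close> into
  \<open>at (cnj x)\<close>.\<close>

lemma eventually_cosparse_cnj:
  assumes "\<forall>\<^sub>\<approx>x\<in>UNIV. P x"
  shows "\<forall>\<^sub>\<approx>x\<in>UNIV. P (cnj x)"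
proof -
  have "filterlim cnj (at (cnj x)) (at x)" for x
    by (intro filterlim_atI tendsto_intros) (auto simp: eventually_at_filter)
  with assms show ?thesis
    by (auto simp: eventually_cosparse_open_eq filterlim_iff)
qed

subsection \<open>Products of factors\<close>

text \<open>Lists rather than sets, since parameters repeat (\<nu> occurs twice for
  \<open>b2 b2\<close>) and a shift acts entry by entry.\<close>

definition tan_prod :: "real list \<Rightarrow> complex \<Rightarrow> complex" where
  "tan_prod as \<zeta> = (\<Prod>a\<leftarrow>as. tan_factor a \<zeta>)"

lemma tan_prod_Nil [simp]: "tan_prod [] \<zeta> = 1"
  and tan_prod_Cons [simp]: "tan_prod (a # as) \<zeta> = tan_factor a \<zeta> * tan_prod as \<zeta>"
  by (simp_all add: tan_prod_def)

lemma tan_prod_minus: "tan_prod as (- \<zeta>) = inverse (tan_prod as \<zeta>)"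
proof -
  have "tan_factor a (- \<zeta>) = inverse (tan_factor a \<zeta>)" for a
  proof -
    define s where "s = \<i> * complex_of_real (sin (pi * a))"
    \<comment> \<open>\<open>sinh\<close> is odd, so numerator and denominator are exchanged up to a
      common sign. With \<open>inverse 0 = 0\<close> this includes zeros and poles.\<close>
    have "(- sinh \<zeta> + s) / (- sinh \<zeta> - s) = (- (sinh \<zeta> - s)) / (- (sinh \<zeta> + s))"
      by simp
    also have "\<dots> = inverse ((sinh \<zeta> + s) / (sinh \<zeta> - s))"
      by (simp only: minus_divide_divide inverse_divide)
    finally show ?thesis
      by (simp add: tan_factor_sinh s_def)
  qed
  then show ?thesis
    by (induction as) simp_all
qed

lemma tan_prod_cnj: "cnj (tan_prod as (cnj \<zeta>)) = inverse (tan_prod as \<zeta>)"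
proof -
  have "cnj (sinh (cnj \<zeta>)) = sinh \<zeta>"
    by (simp add: sinh_field_def exp_cnj)
  then have "cnj (tan_factor a (cnj \<zeta>)) = inverse (tan_factor a \<zeta>)" for a
    by (simp add: tan_factor_sinh)
  then show ?thesis
    by (induction as) simp_all
qed

lemma tan_prod_crossing: "tan_prod as (\<i> * of_real pi - \<zeta>) = tan_prod as \<zeta>"
proof -
  have "sinh (\<i> * of_real pi - \<zeta>) = sinh \<zeta>"
    by (simp add: sinh_diff sinh_i_times cosh_i_times)
  then have "tan_factor a (\<i> * of_real pi - \<zeta>) = tan_factor a \<zeta>" for a
    by (simp add: tan_factor_sinh)
  then show ?thesis
    by (induction as) simp_all
qed

text \<open>Crossing at \<open>- \<zeta>\<close> followed by inversion under sign change. It will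
  reduce the fusion angle \<open>pi * (1 - \<nu>)\<close> to multiples of
  \<open>pi * \<nu> / 2\<close>.\<close>

lemma tan_prod_shift_ipi: "tan_prod as (\<zeta> + \<i> * of_real pi) = inverse (tan_prod as \<zeta>)"
  using tan_prod_crossing[of as "- \<zeta>"] by (simp add: tan_prod_minus add.commute)

text \<open>In the \<open>sinh\<close> form of the factors this says that no denominator vanishes.
  It inspects each factor separately and ignores cancellation, so it is sufficient for
  analyticity.\<close>

definition regular_at :: "real list \<Rightarrow> complex \<Rightarrow> bool" where
  "regular_at as \<zeta> \<longleftrightarrow> (\<forall>a\<in>set as. sinh \<zeta> \<noteq> \<i> * of_real (sin (pi * a)))"

lemma tan_prod_analytic:
  assumes "regular_at as \<zeta>"
  shows "tan_prod as analytic_on {\<zeta>}"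
  using assms
proof (induction as)
  case (Cons a as)
  have "tan_factor a analytic_on {\<zeta>}"
    using Cons.prems unfolding tan_factor_sinh[abs_def]
    by (auto intro!: analytic_intros simp: regular_at_def)
  moreover have "tan_prod as analytic_on {\<zeta>}"
    using Cons by (simp add: regular_at_def)
  moreover have "tan_prod (a # as) = (\<lambda>\<zeta>. tan_factor a \<zeta> * tan_prod as \<zeta>)"
    by auto
  ultimately show ?case
    by (simp add: analytic_on_mult)
qed (simp add: analytic_on_const tan_prod_def[abs_def])

lemma tan_prod_meromorphic [meromorphic_intros]: "tan_prod as meromorphic_on A"
proof -
  have "tan_factor a meromorphic_on A" for a
    unfolding tan_factor_sinh[abs_def]
    by (intro meromorphic_intros analytic_on_imp_meromorphic_on analytic_intros)
  then show ?thesis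
    unfolding tan_prod_def[abs_def] by (intro meromorphic_intros)
qed

lemma tan_factor_cancel:
  "\<forall>\<^sub>\<approx>\<zeta>\<in>UNIV. tan_factor a \<zeta> * tan_factor (- a) \<zeta> = 1"
  using sinh_neq_cosparse[of "\<i> * of_real (sin (pi * a))"]
    sinh_neq_cosparse[of "- \<i> * of_real (sin (pi * a))"]
proof eventually_elim
  case (elim \<zeta>)
  then have "tan_factor a \<zeta> \<noteq> 0"
    by (auto simp: tan_factor_sinh add_eq_0_iff)
  then show ?case
    by (simp add: tan_factor_minus)
qed

lemma tan_prod_nonzero_cosparse: "\<forall>\<^sub>\<approx>\<zeta>\<in>UNIV. tan_prod as \<zeta> \<noteq> 0"
proof (induction as)
  case (Cons a as)
  with tan_factor_cancel[of a] show ?case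
    by eventually_elim auto
qed simp

text \<open>As \<open>sinh 0 = 0\<close>, every factor is a nonzero number divided by its negative.
  The value - 1 in S7 is then a matter of parity.\<close>

lemma tan_prod_at_0:
  assumes "regular_at as 0"
  shows "tan_prod as 0 = (- 1) ^ length as"
  using assms
proof (induction as)
  case (Cons a as)
  then show ?case
    by (simp add: regular_at_def tan_factor_sinh)
qed simp

subsection \<open>Bounds, zeros and poles\<close>

lemma Re_sinh: "Re (sinh \<zeta>) = sinh (Re \<zeta>) * cos (Im \<zeta>)"
  and Im_sinh: "Im (sinh \<zeta>) = cosh (Re \<zeta>) * sin (Im \<zeta>)"
proof -
  have of_real: "sinh (complex_of_real x) = of_real (sinh x)" "cosh (complex_of_real x) = of_real (cosh x)" for x
    by (simp_all add: sinh_field_def cosh_field_def flip: exp_of_real)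
  have "sinh \<zeta> = sinh (of_real (Re \<zeta>) + \<i> * of_real (Im \<zeta>))"
    by (simp flip: complex_eq)
  also have "\<dots> = of_real (sinh (Re \<zeta>) * cos (Im \<zeta>)) + \<i> * of_real (cosh (Re \<zeta>) * sin (Im \<zeta>))"
    unfolding sinh_add sinh_i_times cosh_i_times of_real by simp
  finally have *: "sinh \<zeta> = \<dots>" .
  show "Re (sinh \<zeta>) = sinh (Re \<zeta>) * cos (Im \<zeta>)"
    "Im (sinh \<zeta>) = cosh (Re \<zeta>) * sin (Im \<zeta>)"
    unfolding * by simp_all
qed

text \<open>The bound must be uniform in \<open>Re \<zeta>\<close>. While
  \<open>cosh (Re \<zeta>)\<close> is at most 2, the imaginary part of \<open>sinh \<zeta>\<close>
  stays below half of |s|; beyond that, \<open>sinh (Re \<zeta>)\<close> exceeds 1 in absolute value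
  and the real part alone suffices.\<close>

lemma sinh_avoids_near_real:
  fixes s :: real
  assumes "\<bar>Im \<zeta>\<bar> < 1" and "\<bar>Im \<zeta>\<bar> < \<bar>s\<bar> / 4"
  shows "min (\<bar>s\<bar> / 2) (1 / 2) \<le> cmod (sinh \<zeta> - \<i> * of_real s)"
proof (cases "cosh (Re \<zeta>) \<le> 2")
  case True
  have "\<bar>cosh (Re \<zeta>) * sin (Im \<zeta>)\<bar> \<le> 2 * \<bar>Im \<zeta>\<bar>"
    using True unfolding abs_mult by (intro mult_mono abs_sin_x_le_abs_x) auto
  then have "\<bar>s\<bar> / 2 \<le> \<bar>Im (sinh \<zeta> - \<i> * of_real s)\<bar>"
    using assms abs_triangle_ineq2_sym[of s "cosh (Re \<zeta>) * sin (Im \<zeta>)"] by (simp add: Im_sinh)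
  also have "\<dots> \<le> cmod (sinh \<zeta> - \<i> * of_real s)"
    by (rule abs_Im_le_cmod)
  finally show ?thesis
    by simp
next
  case False
  have "2\<^sup>2 < (cosh (Re \<zeta>))\<^sup>2"
    using False by (intro power_strict_mono) auto
  then have "1\<^sup>2 < \<bar>sinh (Re \<zeta>)\<bar>\<^sup>2"
    by (simp add: cosh_square_eq)
  then have 1: "1 \<le> \<bar>sinh (Re \<zeta>)\<bar>"
    by (smt (verit) power_mono abs_ge_zero)
  \<comment> \<open>\<open>pi / 3\<close> exceeds 1, hence also |Im \<zeta>|.\<close>
  have "cos (pi / 3) \<le> cos \<bar>Im \<zeta>\<bar>"
    using assms pi_gt3 by (intro cos_monotone_0_pi_le) auto
  then have 2: "1 / 2 \<le> \<bar>cos (Im \<zeta>)\<bar>"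
    by (simp add: cos_60)
  have "1 / 2 \<le> \<bar>Re (sinh \<zeta> - \<i> * of_real s)\<bar>"
    using mult_mono[OF 1 2] by (simp add: Re_sinh abs_mult)
  also have "\<dots> \<le> cmod (sinh \<zeta> - \<i> * of_real s)"
    by (rule abs_Re_le_cmod)
  finally show ?thesis
    by simp
qed

text \<open>Each factor is 1 plus a constant over \<open>sinh \<zeta> - \<i> * of_real s\<close>,
  whose modulus is bounded below near the real axis. Regularity is carried along so that
  \<open>remove_sings\<close> changes nothing there.\<close>

lemma tan_prod_bounded_near_real:
  assumes "\<And>a. a \<in> set as \<Longrightarrow> sin (pi * a) \<noteq> 0"
  shows "\<exists>\<kappa>>0. \<exists>B. \<forall>\<zeta>. \<bar>Im \<zeta>\<bar> < \<kappa> \<longrightarrow> regular_at as \<zeta> \<and> cmod (tan_prod as \<zeta>) \<le> B"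
  using assms
proof (induction as)
  case Nil
  show ?case
    by (auto simp: regular_at_def intro!: exI[of _ 1])
next
  case (Cons a as)
  then obtain \<kappa> B where "\<kappa> > 0"
    and IH: "\<And>\<zeta>. \<bar>Im \<zeta>\<bar> < \<kappa> \<Longrightarrow> regular_at as \<zeta> \<and> cmod (tan_prod as \<zeta>) \<le> B"
    by (metis list.set_intros(2))
  define s where "s = sin (pi * a)"
  define \<delta> where "\<delta> = min (\<bar>s\<bar> / 2) (1 / 2)"
  have s: "s \<noteq> 0"
    using Cons.prems by (simp add: s_def)
  then have "\<delta> > 0"
    by (simp add: \<delta>_def)
  have "regular_at (a # as) \<zeta> \<and> cmod (tan_prod (a # as) \<zeta>) \<le> (1 + 2 * \<bar>s\<bar> / \<delta>) * B"
    if "\<bar>Im \<zeta>\<bar> < min \<kappa> (min 1 (\<bar>s\<bar> / 4))" for \<zeta>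
  proof -
    have \<delta>: "\<delta> \<le> cmod (sinh \<zeta> - \<i> * of_real s)"
      using sinh_avoids_near_real[of \<zeta> s] that by (simp add: \<delta>_def)
    with \<open>\<delta> > 0\<close> have ne: "sinh \<zeta> \<noteq> \<i> * of_real s"
      by auto
    then have "tan_factor a \<zeta> = 1 + 2 * \<i> * of_real s / (sinh \<zeta> - \<i> * of_real s)"
      unfolding tan_factor_sinh s_def[symmetric] by (simp add: field_simps)
    also have "cmod \<dots> \<le> 1 + 2 * \<bar>s\<bar> / cmod (sinh \<zeta> - \<i> * of_real s)"
      by (rule order_trans[OF norm_triangle_ineq]) (simp add: norm_mult norm_divide)
    also have "\<dots> \<le> 1 + 2 * \<bar>s\<bar> / \<delta>"
      using \<delta> \<open>\<delta> > 0\<close> by (intro add_left_mono divide_left_mono mult_pos_pos) auto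
    finally have "cmod (tan_factor a \<zeta>) \<le> 1 + 2 * \<bar>s\<bar> / \<delta>" .
    moreover have "regular_at as \<zeta>" "cmod (tan_prod as \<zeta>) \<le> B"
      using IH that by auto
    ultimately show ?thesis
      using ne \<open>\<delta> > 0\<close> by (auto simp: regular_at_def norm_mult s_def intro!: mult_mono)
  qed
  moreover have "min \<kappa> (min 1 (\<bar>s\<bar> / 4)) > 0"
    using s \<open>\<kappa> > 0\<close> by simp
  ultimately show ?case
    by blast
qed

section \<open>Solutions of \<open>sinh \<zeta> = \<i> * of_real (sin (pi * a))\<close> in the open
  strip\<close>

lemma sin_eq_on_0_pi:
  fixes x y :: real
  assumes "sin x = sin y" "0 < x" "x < pi" "0 < y" "y < pi"
  shows "x = y \<or> x = pi - y"
proof -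
  have "sin ((x - y) / 2) * cos ((x + y) / 2) = 0"
    using assms(1) sin_diff_sin[of x y] by simp
  then consider "sin ((x - y) / 2) = 0" | "cos ((x + y) / 2) = 0"
    by fastforce
  then show ?thesis
  proof cases
    case 1
    moreover have "- pi < (x - y) / 2"
      using assms(2-5) by (simp add: field_simps)
    moreover have "(x - y) / 2 < pi"
      using assms(2-5) by (simp add: field_simps)
    ultimately have "(x - y) / 2 = 0"
      using sin_eq_0_pi by blast
    then show ?thesis
      by simp
  next
    case 2
    then have "cos ((x + y) / 2) = cos (pi / 2)"
      by simp
    moreover have "(x + y) / 2 \<in> {0..pi}" "pi / 2 \<in> {0..pi}"
      using assms by auto
    ultimately have "(x + y) / 2 = pi / 2"
      using cos_inj_pi[of "(x + y) / 2" "pi / 2"] by auto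
    then show ?thesis
      by (simp add: field_simps)
  qed
qed

text \<open>All solutions lie on the imaginary axis: the real part of \<open>sinh \<zeta>\<close>
  vanishes, and if this is due to \<open>cos (Im \<zeta>) = 0\<close>, then
  \<open>cosh (Re \<zeta>)\<close> is a sine, hence 1. What remains is an equation between sines,
  with \<open>sin (Im \<zeta>)\<close> positive.\<close>

lemma sinh_eq_in_strip:
  assumes "0 < Im \<zeta>" "Im \<zeta> < pi" and sinh: "sinh \<zeta> = \<i> * of_real (sin (pi * a))"
  shows "sin (pi * a) > 0"
    and "0 < a \<Longrightarrow> a < 1 \<Longrightarrow> \<zeta> = \<i> * of_real (pi * a) \<or> \<zeta> = \<i> * of_real (pi * (1 - a))"
proof -
  have "sinh (Re \<zeta>) * cos (Im \<zeta>) = 0" and im: "cosh (Re \<zeta>) * sin (Im \<zeta>) = sin (pi * a)"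
    using sinh by (simp_all flip: Re_sinh Im_sinh)
  then consider "Re \<zeta> = 0" | "cos (Im \<zeta>) = 0"
    by auto
  then have "Re \<zeta> = 0"
  proof cases
    case 2
    then have "sin (Im \<zeta>) = 1"
      using sin_cos_squared_add[of "Im \<zeta>"] sin_gt_zero[of "Im \<zeta>"] assms by (simp add: power2_eq_1_iff)
    with im have "cosh (Re \<zeta>) \<le> 1"
      by (simp add: sin_le_one)
    then have "cosh (Re \<zeta>) = 1"
      using cosh_real_ge_1[of "Re \<zeta>"] by linarith
    then show ?thesis
      using cosh_square_eq[of "Re \<zeta>"] by simp
  qed
  then have \<zeta>: "\<zeta> = \<i> * of_real (Im \<zeta>)" and sin: "sin (Im \<zeta>) = sin (pi * a)"
    using im by (simp_all add: complex_eq_iff)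
  show "sin (pi * a) > 0"
    using sin_gt_zero[of "Im \<zeta>"] assms sin by simp
  assume "0 < a" "a < 1"
  then have "Im \<zeta> = pi * a \<or> Im \<zeta> = pi * (1 - a)"
    using sin_eq_on_0_pi[OF sin] assms by (simp add: right_diff_distrib)
  with \<zeta> show "\<zeta> = \<i> * of_real (pi * a) \<or> \<zeta> = \<i> * of_real (pi * (1 - a))"
    by metis
qed

lemma finite_sinh_eq_in_strip:
  "finite {\<zeta>. 0 < Im \<zeta> \<and> Im \<zeta> < pi \<and> sinh \<zeta> = \<i> * of_real (sin (pi * a))}" (is "finite ?A")
proof -
  \<comment> \<open>The parameter a is arbitrary; b has the same sine and lies in (0, 1/2] as soon
    as there is a solution.\<close>
  define b where "b = arcsin (sin (pi * a)) / pi"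
  have b: "sin (pi * b) = sin (pi * a)"
    by (simp add: b_def)
  have "?A \<subseteq> {\<i> * of_real (pi * b), \<i> * of_real (pi * (1 - b))}"
  proof
    fix \<zeta> assume "\<zeta> \<in> ?A"
    then have *: "0 < Im \<zeta>" "Im \<zeta> < pi" "sinh \<zeta> = \<i> * of_real (sin (pi * b))"
      by (auto simp: b)
    have "0 < arcsin (sin (pi * a))" "arcsin (sin (pi * a)) \<le> pi / 2"
      using sinh_eq_in_strip(1)[OF *] arcsin_less_arcsin[of 0 "sin (pi * a)"]
        arcsin_bounded[of "sin (pi * a)"] by (auto simp: b)
    then have "0 < b" "b < 1"
      unfolding b_def using pi_gt_zero by (auto simp: field_simps)
    with sinh_eq_in_strip(2)[OF *] show "\<zeta> \<in> {\<i> * of_real (pi * b), \<i> * of_real (pi * (1 - b))}"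
      by simp
  qed
  then show ?thesis
    by (rule finite_subset) simp
qed

lemma finite_strip_zeros_tan_prod: "finite (strip_zeros (remove_sings (tan_prod as)))"
proof -
  define Z where "Z a = {\<zeta>. 0 < Im \<zeta> \<and> Im \<zeta> < pi \<and> sinh \<zeta> = \<i> * of_real (sin (pi * a))}" for a
  \<comment> \<open>\<open>Z (- a)\<close> holds the numerator roots. The denominator roots
    \<open>Z a\<close> are included because after cancellation \<open>remove_sings\<close> may
    produce a zero there.\<close>
  have "strip_zeros (remove_sings (tan_prod as)) \<subseteq> (\<Union>a\<in>set as. Z a \<union> Z (- a))"
  proof
    fix \<zeta> assume \<zeta>: "\<zeta> \<in> strip_zeros (remove_sings (tan_prod as))"
    show "\<zeta> \<in> (\<Union>a\<in>set as. Z a \<union> Z (- a))"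
    proof (rule ccontr)
      assume *: "\<zeta> \<notin> (\<Union>a\<in>set as. Z a \<union> Z (- a))"
      then have reg: "regular_at as \<zeta>"
        using \<zeta> by (auto simp: strip_zeros_def regular_at_def Z_def)
      have "tan_factor a \<zeta> \<noteq> 0" if "a \<in> set as" for a
        using * \<zeta> that by (auto simp: strip_zeros_def Z_def tan_factor_sinh add_eq_0_iff)
      then have "tan_prod as \<zeta> \<noteq> 0"
        by (auto simp: tan_prod_def prod_list_zero_iff)
      then show False
        using \<zeta> tan_prod_analytic[OF reg] by (simp add: strip_zeros_def)
    qed
  qed
  moreover have "finite (Z a)" for a
    unfolding Z_def by (rule finite_sinh_eq_in_strip)
  ultimately show ?thesis
    by (auto intro: finite_subset)
qed

text \<open>The product is f / g with \<open>g z = 0\<close> and g' = \<open>cosh\<close> nonzero at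
  z, so the residue is f(z) / c. The assumption on absolute values keeps numerators and denominators
  of the other factors nonzero at z; each of these factors is real there because \<i>
  cancels.\<close>

lemma tan_prod_simple_pole:
  assumes sinh: "sinh z = \<i> * of_real (sin (pi * a))" and c: "cosh z = of_real c" "c \<noteq> 0"
    and a: "sin (pi * a) \<noteq> 0"
    and bs: "\<And>b. b \<in> set bs \<Longrightarrow> \<bar>sin (pi * b)\<bar> \<noteq> \<bar>sin (pi * a)\<bar>"
  shows "is_pole (remove_sings (tan_prod (a # bs))) z"
    and "zorder (remove_sings (tan_prod (a # bs))) z = - 1"
    and "residue (remove_sings (tan_prod (a # bs))) z = \<i> * of_real (2 * sin (pi * a) / c *
           (\<Prod>b\<leftarrow>bs. (sin (pi * a) + sin (pi * b)) / (sin (pi * a) - sin (pi * b))))"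
proof -
  define s where "s a = sin (pi * a)" for a
  define f where "f \<zeta> = (sinh \<zeta> + \<i> * of_real (s a)) * tan_prod bs \<zeta>" for \<zeta>
  define g where "g \<zeta> = sinh \<zeta> - \<i> * complex_of_real (s a)" for \<zeta>
  have sinh': "sinh z = \<i> * of_real (s a)"
    using sinh by (simp add: s_def)
  have eq: "tan_prod (a # bs) = (\<lambda>\<zeta>. f \<zeta> / g \<zeta>)"
    by (auto simp: f_def g_def tan_factor_sinh s_def)
  have ne: "s a \<noteq> s b" "s a + s b \<noteq> 0" if "b \<in> set bs" for b
    using bs[OF that] by (auto simp: s_def abs_eq_iff)
  have reg: "regular_at bs z"
    using ne(1) by (auto simp: regular_at_def sinh' s_def)
  have at_z: "tan_prod bs z = of_real (\<Prod>b\<leftarrow>bs. (s a + s b) / (s a - s b))"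
  proof -
    have "tan_factor b z = of_real ((s a + s b) / (s a - s b))" for b
    proof -
      have "tan_factor b z = (\<i> * of_real (s a + s b)) / (\<i> * of_real (s a - s b))"
        unfolding tan_factor_sinh sinh' s_def[symmetric] by (simp add: algebra_simps)
      then show ?thesis
        by simp
    qed
    then show ?thesis
      by (induction bs) simp_all
  qed
  have fz: "f z = \<i> * of_real (2 * s a * (\<Prod>b\<leftarrow>bs. (s a + s b) / (s a - s b)))"
    by (simp add: f_def sinh' at_z)
  moreover have "(\<Prod>b\<leftarrow>bs. (s a + s b) / (s a - s b)) \<noteq> 0"
    using ne by (auto simp: prod_list_zero_iff)
  ultimately have "f z \<noteq> 0"
    using a by (simp add: s_def)
  have "f analytic_on {z}"
    unfolding f_def by (intro analytic_intros tan_prod_analytic reg)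
  then obtain r where r: "r > 0" "f holomorphic_on ball z r"
    by (auto simp: analytic_on_def)
  have g: "g holomorphic_on ball z r"
    unfolding g_def by (intro analytic_imp_holomorphic analytic_intros)
  have g': "(g has_field_derivative of_real c) (at z)"
    unfolding g_def using c by (auto intro!: derivative_eq_intros)
  have gz: "g z = 0"
    by (simp add: g_def sinh')
  have iso: "isolated_singularity_at (tan_prod (a # bs)) z"
    by (rule meromorphic_on_isolated_singularity[OF tan_prod_meromorphic])
  have zor: "zorder (tan_prod (a # bs)) z = - 1"
    unfolding eq using r c(2) \<open>f z \<noteq> 0\<close> gz
    by (intro porder_simple_pole_deriv[OF r(2) g _ _ _ g']) auto
  then show "zorder (remove_sings (tan_prod (a # bs))) z = - 1"
    using iso by simp
  have "residue (tan_prod (a # bs)) z = f z / of_real c"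
    unfolding eq using r c(2) \<open>f z \<noteq> 0\<close> gz
    by (intro residue_simple_pole_deriv[OF r(2) g _ _ _ g']) auto
  then show "residue (remove_sings (tan_prod (a # bs))) z = \<i> * of_real (2 * sin (pi * a) / c *
           (\<Prod>b\<leftarrow>bs. (sin (pi * a) + sin (pi * b)) / (sin (pi * a) - sin (pi * b))))"
    using iso by (simp add: fz s_def)
  \<comment> \<open>The order is informative only for a function that does not vanish identically
    near z, hence the appeal to \<open>tan_prod_nonzero_cosparse\<close>.\<close>
  have "is_pole (tan_prod (a # bs)) z"
    using zor by (intro zorder_neg_imp_is_pole tan_prod_meromorphic
        eventually_cosparse_imp_eventually_at[OF tan_prod_nonzero_cosparse]) auto
  then show "is_pole (remove_sings (tan_prod (a # bs))) z"
    using iso by simp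
qed

text \<open>Negative sines keep the denominators for \<open>bs\<close> free of roots in the strip,
  so only a contributes. Its two poles have the same \<open>sinh\<close> and opposite
  \<open>cosh\<close>, hence opposite residues; \<open>a \<noteq> 1 / 2\<close> keeps them apart and
  simple.\<close>

lemma strip_poles_tan_prod:
  assumes a: "0 < a" "a < 1" "a \<noteq> 1 / 2"
    and bs: "\<forall>b\<in>set bs. sin (pi * b) < 0 \<and> - sin (pi * b) \<noteq> sin (pi * a)"
  defines "S \<equiv> remove_sings (tan_prod (a # bs))"
    and "R \<equiv> (\<Prod>b\<leftarrow>bs. (sin (pi * a) + sin (pi * b)) / (sin (pi * a) - sin (pi * b)))"
  shows "strip_poles S = {\<i> * of_real (pi * a), \<i> * of_real (pi * (1 - a))}"
    and "\<zeta> \<in> strip_poles S \<Longrightarrow> zorder S \<zeta> = - 1"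
    and "residue S (\<i> * of_real (pi * a)) = \<i> * of_real (2 * sin (pi * a) / cos (pi * a) * R)"
    and "residue S (\<i> * of_real (pi * (1 - a))) = \<i> * of_real (- 2 * sin (pi * a) / cos (pi * a) * R)"
proof -
  have sa: "sin (pi * a) > 0"
    using a by (intro sin_gt_zero) auto
  have ca: "cos (pi * a) \<noteq> 0"
  proof
    assume "cos (pi * a) = 0"
    then have "cos (pi * a) = cos (pi / 2)"
      by simp
    then have "pi * a = pi / 2"
      using cos_inj_pi[of "pi * a" "pi / 2"] a by simp
    then show False
      using a by simp
  qed
  have bs': "\<bar>sin (pi * b)\<bar> \<noteq> \<bar>sin (pi * a)\<bar>" if "b \<in> set bs" for b
    using bs that sa by fastforce
  have sin': "sin (pi * (1 - a)) = sin (pi * a)" and cos': "cos (pi * (1 - a)) = - cos (pi * a)"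
    by (simp_all add: right_diff_distrib sin_diff cos_diff)
  note p1 = tan_prod_simple_pole[of "\<i> * of_real (pi * a)" a "cos (pi * a)", OF sinh_i_times cosh_i_times ca _ bs']
  have "sinh (\<i> * of_real (pi * (1 - a))) = \<i> * complex_of_real (sin (pi * a))"
    "cosh (\<i> * of_real (pi * (1 - a))) = complex_of_real (- cos (pi * a))"
    "- cos (pi * a) \<noteq> 0"
    unfolding sinh_i_times cosh_i_times sin' cos' using ca by auto
  note p2 = tan_prod_simple_pole[OF this _ bs']
  have "\<zeta> = \<i> * of_real (pi * a) \<or> \<zeta> = \<i> * of_real (pi * (1 - a))" if "\<zeta> \<in> strip_poles S" for \<zeta>
  proof (rule ccontr)
    assume *: "\<not> ?thesis"
    have strip: "0 < Im \<zeta>" "Im \<zeta> < pi" and pole: "is_pole S \<zeta>"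
      using that by (auto simp: strip_poles_def)
    have "sinh \<zeta> \<noteq> \<i> * of_real (sin (pi * b))" if "b \<in> set bs" for b
      using sinh_eq_in_strip(1)[OF strip, of b] bs that by force
    moreover have "sinh \<zeta> \<noteq> \<i> * of_real (sin (pi * a))"
      using sinh_eq_in_strip(2)[OF strip _ a(1,2)] * by blast
    ultimately have "regular_at (a # bs) \<zeta>"
      by (auto simp: regular_at_def)
    then have "S analytic_on {\<zeta>}"
      unfolding S_def by (intro remove_sings_analytic_on tan_prod_analytic)
    then show False
      using pole analytic_at_imp_no_pole by blast
  qed
  then show poles: "strip_poles S = {\<i> * of_real (pi * a), \<i> * of_real (pi * (1 - a))}"
    using p1(1) p2(1) a sa unfolding S_def by (auto simp: strip_poles_def)
  show "zorder S \<zeta> = - 1" if "\<zeta> \<in> strip_poles S"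
    using that p1(2) p2(2) sa unfolding poles by (auto simp: S_def)
  show "residue S (\<i> * of_real (pi * a)) = \<i> * of_real (2 * sin (pi * a) / cos (pi * a) * R)"
    using p1(3) sa by (simp add: S_def R_def)
  show "residue S (\<i> * of_real (pi * (1 - a))) = \<i> * of_real (- 2 * sin (pi * a) / cos (pi * a) * R)"
    using p2(3) sa by (simp add: S_def R_def)
qed

subsection \<open>Reduced products and bootstrap\<close>

lemma tan_prod_shift:
  "tan_prod as (\<zeta> + \<i> * of_real (pi * c)) * tan_prod as (\<zeta> - \<i> * of_real (pi * c)) =
   tan_prod (concat (map (\<lambda>a. [a + c, a - c]) as)) \<zeta>"
proof (induction as)
  case (Cons a as)
  then show ?case
    using tan_factor_shift[of a \<zeta> c] by (simp add: mult_ac)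
qed simp

text \<open>The parameters of \<open>S\<^sub>k\<^sub>l\<close> left after cancelling all pairs \<open>a\<close>, \<open>- a\<close>; \<open>\<nu>p\<close> is eliminated by
  \<open>\<nu>m + \<nu>p = 1 - \<nu>\<close>. In \<open>S\<^sub>1\<^sub>1\<close> and \<open>S\<^sub>1\<^sub>2\<close> the first parameter is the one that causes the poles.\<close>

fun tan_params :: "real \<Rightarrow> real \<Rightarrow> breather \<Rightarrow> breather \<Rightarrow> real list" where
  "tan_params \<nu> \<nu>m b1 b1 = [\<nu>, \<nu>m - \<nu>, - \<nu>m]"
| "tan_params \<nu> \<nu>m b2 b2 = [2 * \<nu>, \<nu>, \<nu>, \<nu>m - \<nu>, \<nu>m - 2 * \<nu>, - \<nu>m, - \<nu> - \<nu>m]"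
| "tan_params \<nu> \<nu>m _ _ = [\<nu> / 2, 3 * \<nu> / 2, \<nu>m - 3 * \<nu> / 2, - \<nu> / 2 - \<nu>m]"

lemma CDD11_eq_tan_prod:
  assumes "1 - \<nu> = \<nu>m + \<nu>p"
  shows "CDD11 \<nu> \<nu>m \<nu>p \<zeta> = tan_prod [\<nu>m - \<nu>, - \<nu>m] \<zeta>"
proof -
  \<comment> \<open>The constraint makes the second and fourth \<open>h_factor\<close> a pair a, 1 -
    a, like the first and third. The signs of the two pairs cancel.\<close>
  have eq: "\<nu> + \<nu>p = 1 - \<nu>m" "1 - \<nu> - \<nu>p = 1 - (1 - \<nu>m)" "1 - \<nu> + \<nu>m = 1 - (\<nu> - \<nu>m)"
    using assms by simp_all
  have "CDD11 \<nu> \<nu>m \<nu>p \<zeta> = (h_factor (\<nu> - \<nu>m) \<zeta> * h_factor (1 - (\<nu> - \<nu>m)) \<zeta>) *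
      (h_factor (1 - \<nu>m) \<zeta> * h_factor (1 - (1 - \<nu>m)) \<zeta>)"
    unfolding CDD11_def eq by (simp only: mult_ac)
  also have "\<dots> = tan_factor (- (\<nu> - \<nu>m)) \<zeta> * tan_factor (- (1 - \<nu>m)) \<zeta>"
    unfolding h_factor_pair by simp
  also have "tan_factor (- (1 - \<nu>m)) \<zeta> = tan_factor (- \<nu>m) \<zeta>"
    by (simp only: tan_factor_minus tan_factor_reflect)
  finally show ?thesis
    by simp
qed

text \<open>The opposite parameters \<open>\<nu>m - \<nu> / 2\<close> and
  \<open>\<nu> / 2 - \<nu>m\<close> are kept: without cancellation the identity holds at every point
  and can be shifted again for \<open>CDD22\<close>.\<close>

lemma CDD12_eq_tan_prod:
  assumes "1 - \<nu> = \<nu>m + \<nu>p"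
  shows "CDD12 \<nu> \<nu>m \<nu>p \<zeta> = tan_prod [\<nu>m - \<nu> / 2, \<nu>m - 3 * \<nu> / 2, \<nu> / 2 - \<nu>m, - \<nu> / 2 - \<nu>m] \<zeta>"
proof -
  have *: "concat (map (\<lambda>a. [a + \<nu> / 2, a - \<nu> / 2]) [\<nu>m - \<nu>, - \<nu>m]) =
      [\<nu>m - \<nu> / 2, \<nu>m - 3 * \<nu> / 2, \<nu> / 2 - \<nu>m, - \<nu> / 2 - \<nu>m]"
    by (simp add: field_simps)
  show ?thesis
    using tan_prod_shift[of "[\<nu>m - \<nu>, - \<nu>m]" \<zeta> "\<nu> / 2"]
    unfolding CDD12_def CDD11_eq_tan_prod[OF assms] * times_divide_eq_right .
qed

lemma CDD22_eq_tan_prod: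
  assumes "1 - \<nu> = \<nu>m + \<nu>p"
  shows "CDD22 \<nu> \<nu>m \<nu>p \<zeta> =
    tan_prod [\<nu>m, \<nu>m - \<nu>, \<nu>m - \<nu>, \<nu>m - 2 * \<nu>, \<nu> - \<nu>m, - \<nu>m, - \<nu>m, - \<nu> - \<nu>m] \<zeta>"
proof -
  have *: "concat (map (\<lambda>a. [a + \<nu> / 2, a - \<nu> / 2])
        [\<nu>m - \<nu> / 2, \<nu>m - 3 * \<nu> / 2, \<nu> / 2 - \<nu>m, - \<nu> / 2 - \<nu>m]) =
      [\<nu>m, \<nu>m - \<nu>, \<nu>m - \<nu>, \<nu>m - 2 * \<nu>, \<nu> - \<nu>m, - \<nu>m, - \<nu>m, - \<nu> - \<nu>m]"
    by (simp add: field_simps)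
  show ?thesis
    using tan_prod_shift[of "[\<nu>m - \<nu> / 2, \<nu>m - 3 * \<nu> / 2, \<nu> / 2 - \<nu>m, - \<nu> / 2 - \<nu>m]" \<zeta> "\<nu> / 2"]
    unfolding CDD22_def CDD12_eq_tan_prod[OF assms] * times_divide_eq_right .
qed

text \<open>Opposite parameters are cancelled here. At zeros and poles of a cancelled factor the
  product is 0 by convention, so the identity holds off a sparse set.\<close>

lemma S_product_eq_tan_prod:
  assumes "1 - \<nu> = \<nu>m + \<nu>p"
  shows "\<forall>\<^sub>\<approx>\<zeta>\<in>UNIV. S_SG \<nu> k l \<zeta> * S_CDD \<nu> \<nu>m \<nu>p k l \<zeta> = tan_prod (tan_params \<nu> \<nu>m k l) \<zeta>"
proof -
  note CDD = CDD11_eq_tan_prod[OF assms] CDD12_eq_tan_prod[OF assms] CDD22_eq_tan_prod[OF assms]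
  have 12: "\<forall>\<^sub>\<approx>\<zeta>\<in>UNIV. tan_factor (3 * \<nu> / 2) \<zeta> * tan_factor (\<nu> / 2) \<zeta> * CDD12 \<nu> \<nu>m \<nu>p \<zeta> =
      tan_prod (tan_params \<nu> \<nu>m b1 b2) \<zeta>"
    using tan_factor_cancel[of "\<nu>m - \<nu> / 2"]
  proof eventually_elim
    case (elim \<zeta>)
    then have "tan_factor (\<nu>m - \<nu> / 2) \<zeta> * tan_factor (\<nu> / 2 - \<nu>m) \<zeta> = 1"
      by simp
    then show ?case
      unfolding CDD tan_params.simps tan_prod_Cons tan_prod_Nil by algebra
  qed
  have 22: "\<forall>\<^sub>\<approx>\<zeta>\<in>UNIV. tan_factor (2 * \<nu>) \<zeta> * (tan_factor \<nu> \<zeta>)\<^sup>2 * CDD22 \<nu> \<nu>m \<nu>p \<zeta> =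
      tan_prod (tan_params \<nu> \<nu>m b2 b2) \<zeta>"
    using tan_factor_cancel[of "\<nu>m - \<nu>"] tan_factor_cancel[of \<nu>m]
  proof eventually_elim
    case (elim \<zeta>)
    then have "tan_factor (\<nu>m - \<nu>) \<zeta> * tan_factor (\<nu> - \<nu>m) \<zeta> = 1"
      "tan_factor \<nu>m \<zeta> * tan_factor (- \<nu>m) \<zeta> = 1"
      by simp_all
    then show ?case
      unfolding CDD tan_params.simps tan_prod_Cons tan_prod_Nil by algebra
  qed
  show ?thesis
    using 12 22 by (cases k; cases l) (simp_all add: CDD)
qed

lemma tan_prod_bootstrap:
  "\<forall>\<^sub>\<approx>\<zeta>\<in>UNIV. tan_prod (tan_params \<nu> \<nu>m b2 \<mu>) \<zeta> =
     tan_prod (tan_params \<nu> \<nu>m b1 \<mu>) (\<zeta> + \<i> * of_real (pi * \<nu> / 2)) *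
     tan_prod (tan_params \<nu> \<nu>m b1 \<mu>) (\<zeta> - \<i> * of_real (pi * \<nu> / 2))"
proof (cases \<mu>)
  case b1
  have *: "concat (map (\<lambda>a. [a + \<nu> / 2, a - \<nu> / 2]) (tan_params \<nu> \<nu>m b1 b1)) =
      [3 * \<nu> / 2, \<nu> / 2, \<nu>m - \<nu> / 2, \<nu>m - 3 * \<nu> / 2, - (\<nu>m - \<nu> / 2), - \<nu> / 2 - \<nu>m]"
    by (simp add: field_simps)
  show ?thesis
    using tan_factor_cancel[of "\<nu>m - \<nu> / 2"]
  proof eventually_elim
    case (elim \<zeta>)
    then have "tan_prod (tan_params \<nu> \<nu>m b2 b1) \<zeta> =
        tan_prod [3 * \<nu> / 2, \<nu> / 2, \<nu>m - \<nu> / 2, \<nu>m - 3 * \<nu> / 2, - (\<nu>m - \<nu> / 2), - \<nu> / 2 - \<nu>m] \<zeta>"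
      unfolding tan_params.simps tan_prod_Cons tan_prod_Nil by algebra
    then show ?case
      using tan_prod_shift[of "tan_params \<nu> \<nu>m b1 b1" \<zeta> "\<nu> / 2"]
      unfolding b1 * times_divide_eq_right by simp
  qed
next
  case b2
  have *: "concat (map (\<lambda>a. [a + \<nu> / 2, a - \<nu> / 2]) (tan_params \<nu> \<nu>m b1 b2)) =
      [\<nu>, 0, 2 * \<nu>, \<nu>, \<nu>m - \<nu>, \<nu>m - 2 * \<nu>, - \<nu>m, - \<nu> - \<nu>m]"
    by (simp add: field_simps)
  show ?thesis
    \<comment> \<open>The shift produces the surplus parameter 0, whose factor
      \<open>sinh \<zeta> / sinh \<zeta>\<close> is 1 off the roots of \<open>sinh\<close>.\<close>
    using sinh_neq_cosparse[of 0]
  proof eventually_elim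
    case (elim \<zeta>)
    then have "tan_factor 0 \<zeta> = 1"
      by (simp add: tan_factor_sinh)
    then have "tan_prod (tan_params \<nu> \<nu>m b2 b2) \<zeta> =
        tan_prod [\<nu>, 0, 2 * \<nu>, \<nu>, \<nu>m - \<nu>, \<nu>m - 2 * \<nu>, - \<nu>m, - \<nu> - \<nu>m] \<zeta>"
      unfolding tan_params.simps tan_prod_Cons tan_prod_Nil by algebra
    then show ?case
      using tan_prod_shift[of "tan_params \<nu> \<nu>m b1 b2" \<zeta> "\<nu> / 2"]
      unfolding b2 * times_divide_eq_right by simp
  qed
qed

section \<open>Signs and comparison of sines\<close>

lemma sin_pi_pos: "0 < a \<Longrightarrow> a < 1 \<Longrightarrow> sin (pi * a) > 0"
  by (intro sin_gt_zero) auto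

lemma sin_pi_neg: "- 1 < a \<Longrightarrow> a < 0 \<Longrightarrow> sin (pi * a) < 0"
  using sin_pi_pos[of "- a"] by simp

lemma sin_pi_neg': "1 < a \<Longrightarrow> a < 2 \<Longrightarrow> sin (pi * a) < 0"
  using sin_pi_pos[of "a - 1"] by (simp add: right_diff_distrib sin_diff)

text \<open>The sine of pi times a is symmetric about a = 1/2, so b can be compared with whichever
  of a and 1 - a is at most 1/2.\<close>

lemma sin_pi_less:
  assumes "0 < b" "b < a" "b < 1 - a"
  shows "sin (pi * b) < sin (pi * a)"
proof -
  have *: "sin (pi * b) < sin (pi * c)" if "b < c" "c \<le> 1 / 2" for c
    using assms that by (intro sin_monotone_2pi) (auto intro: order_trans[of _ 0])
  have "sin (pi * (1 - a)) = sin (pi * a)"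
    by (simp add: right_diff_distrib sin_diff)
  with *[of a] *[of "1 - a"] assms show ?thesis
    by (cases "a \<le> 1 / 2") auto
qed

text \<open>\<open>remove_sings\<close> depends only on punctured neighbourhoods, which turns the
  cosparse identity into equality everywhere.\<close>

lemma S_mat_eq_tan_prod:
  assumes "1 - \<nu> = \<nu>m + \<nu>p"
  shows "S_mat \<nu> \<nu>m \<nu>p k l = remove_sings (tan_prod (tan_params \<nu> \<nu>m k l))"
  unfolding S_mat_def
  using S_product_eq_tan_prod[OF assms, of k l]
  by (intro ext remove_sings_cong) (auto simp: eventually_cosparse_open_eq)

lemma sin_tan_params_nonzero:
  assumes "2 / 3 < \<nu>" "\<nu> < 4 / 5" "0 < \<nu>m" "3 / 2 * \<nu> - 1 < \<nu>m" "\<nu>m < 1 - \<nu>"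
    and "a \<in> set (tan_params \<nu> \<nu>m k l)"
  shows "sin (pi * a) \<noteq> 0"
proof -
  \<comment> \<open>No parameter is an integer. The last interval is for
    \<open>\<nu>m - 2 * \<nu>\<close>, which is below - 1 since
    \<open>\<nu>m < 1 - \<nu>\<close>.\<close>
  have "(- 1 < a \<and> a < 0) \<or> (0 < a \<and> a < 1) \<or> (1 < a \<and> a < 2) \<or> (1 < - a \<and> - a < 2)"
    using assms by (cases k; cases l) auto
  then show ?thesis
    using sin_pi_pos[of a] sin_pi_neg[of a] sin_pi_neg'[of a] sin_pi_neg'[of "- a"] by auto
qed

theorem mainTheorem1:
  fixes \<nu> :: real
  assumes "2 / 3 < \<nu>" and "\<nu> < 4 / 5"
  shows "(\<exists>\<nu>m \<nu>p. admissible \<nu> \<nu>m \<nu>p) \<and>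
    (\<forall>\<nu>m \<nu>p. admissible \<nu> \<nu>m \<nu>p \<longrightarrow>
      (let S = S_mat \<nu> \<nu>m \<nu>p in
        (\<forall>k l. S k l meromorphic_on UNIV) \<and>
        (\<forall>k l. \<forall>\<^sub>\<approx>\<zeta>\<in>UNIV. S k l \<zeta> = S l k \<zeta>) \<and>
        (\<forall>k l. \<forall>\<^sub>\<approx>\<zeta>\<in>UNIV. inverse (S k l \<zeta>) = cnj (S l k (cnj \<zeta>))) \<and>
        (\<forall>k l. \<forall>\<^sub>\<approx>\<zeta>\<in>UNIV. S k l \<zeta> = inverse (S k l (- \<zeta>))) \<and>
        (\<forall>k l. \<forall>\<^sub>\<approx>\<zeta>\<in>UNIV. S k l (\<i> * of_real pi - \<zeta>) = S l k \<zeta>) \<and>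
        (\<forall>(\<alpha>, \<beta>, \<gamma>) \<in> fusions. \<forall>\<mu>. \<forall>\<^sub>\<approx>\<zeta>\<in>UNIV.
           S \<gamma> \<mu> \<zeta> = S \<alpha> \<mu> (\<zeta> + \<i> * of_real (fusion_angle \<nu> \<gamma> \<alpha> \<beta>)) *
                     S \<beta> \<mu> (\<zeta> - \<i> * of_real (fusion_angle \<nu> \<gamma> \<beta> \<alpha>))) \<and>
        (\<forall>k. S k k 0 = - 1) \<and>
        (\<forall>k l. finite (strip_zeros (S k l))) \<and>
        (\<exists>\<kappa>>0. \<forall>k l. bdd_above {cmod (S k l \<zeta>) | \<zeta>. - \<kappa> < Im \<zeta> \<and> Im \<zeta> < \<kappa>}) \<and>
        strip_poles (S b1 b1) = {\<i> * of_real (pi * \<nu>), \<i> * of_real (pi * (1 - \<nu>))} \<and>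
        card (strip_poles (S b1 b1)) = 2 \<and>
        (\<forall>\<zeta>\<in>strip_poles (S b1 b1). zorder (S b1 b1) \<zeta> = - 1) \<and>
        strip_poles (S b1 b2) = {\<i> * of_real (pi * (1 - \<nu> / 2)), \<i> * of_real (pi * \<nu> / 2)} \<and>
        card (strip_poles (S b1 b2)) = 2 \<and>
        (\<forall>\<zeta>\<in>strip_poles (S b1 b2). zorder (S b1 b2) \<zeta> = - 1) \<and>
        (\<exists>r>0. residue (S b1 b1) (\<i> * of_real (pi * \<nu>)) = \<i> * of_real r) \<and>
        (\<exists>r>0. residue (S b1 b2) (\<i> * of_real (pi * (1 - \<nu> / 2))) = \<i> * of_real r)))"
proof (intro conjI allI impI, goal_cases)
  case 1
  show "\<exists>\<nu>m \<nu>p. admissible \<nu> \<nu>m \<nu>p"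
    \<comment> \<open>For \<nu>m = \<nu> / 4, half its upper bound, both its lower bound and
      \<open>\<nu>p > 0\<close> amount to \<nu> < 4/5.\<close>
    using assms by (intro exI[of _ "\<nu> / 4"] exI[of _ "1 - 5 * \<nu> / 4"]) (auto simp: admissible_def)
next
  case (2 \<nu>m \<nu>p)
  then have sum: "1 - \<nu> = \<nu>m + \<nu>p" and \<nu>m: "0 < \<nu>m" "3 / 2 * \<nu> - 1 < \<nu>m" "\<nu>m < 1 - \<nu>"
    by (auto simp: admissible_def)
  note bounds = assms \<nu>m
  define E where "E k l = tan_prod (tan_params \<nu> \<nu>m k l)" for k l
  define S where "S = S_mat \<nu> \<nu>m \<nu>p"
  have S: "S k l = remove_sings (E k l)" for k l
    unfolding S_def E_def by (rule S_mat_eq_tan_prod[OF sum])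
  have E_mero: "E k l meromorphic_on UNIV" for k l
    unfolding E_def by (rule tan_prod_meromorphic)
  have E_sym: "E k l = E l k" for k l
    unfolding E_def by (cases k; cases l) simp_all
  have SE: "\<forall>\<^sub>\<approx>\<zeta>\<in>UNIV. S k l \<zeta> = E k l \<zeta>" for k l
    unfolding S by (rule eventually_remove_sings_eq[OF E_mero])
  note SE_shift = eventually_cosparse_shift[OF SE]
  have S1: "S k l meromorphic_on UNIV" for k l
    unfolding S by (rule remove_sings_meromorphic[OF E_mero])
  have S2: "\<forall>\<^sub>\<approx>\<zeta>\<in>UNIV. S k l \<zeta> = S l k \<zeta>" for k l
    unfolding S E_sym[of k l] by simp
  have S3: "\<forall>\<^sub>\<approx>\<zeta>\<in>UNIV. inverse (S k l \<zeta>) = cnj (S l k (cnj \<zeta>))" for k l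
    using SE[of k l] eventually_cosparse_cnj[OF SE[of l k]]
    by eventually_elim (simp add: E_sym[of l k], simp add: E_def tan_prod_cnj)
  have S4: "\<forall>\<^sub>\<approx>\<zeta>\<in>UNIV. S k l \<zeta> = inverse (S k l (- \<zeta>))" for k l
    using SE[of k l] eventually_cosparse_minus[OF SE[of k l]]
    by eventually_elim (simp add: E_def tan_prod_minus)
  have S5: "\<forall>\<^sub>\<approx>\<zeta>\<in>UNIV. S k l (\<i> * of_real pi - \<zeta>) = S l k \<zeta>" for k l
    \<comment> \<open>Negation followed by the shift yields the argument
      \<open>\<i> * of_real pi - \<zeta>\<close>.\<close>
    using SE[of l k] eventually_cosparse_shift[OF eventually_cosparse_minus[OF SE[of k l]], of "- \<i> * of_real pi"]
    by eventually_elim (simp add: E_sym[of l k], simp add: E_def tan_prod_crossing)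

  \<comment> \<open>Bootstrap equations\<close>
  define d where "d = \<i> * complex_of_real (pi * \<nu> / 2)"
  define p where "p = \<i> * complex_of_real pi"
  have angle: "\<i> * complex_of_real (pi * (1 - \<nu>)) = p - d - d"
    by (simp add: d_def p_def field_simps)
  have boot: "\<forall>\<^sub>\<approx>\<zeta>\<in>UNIV. E b2 \<mu> \<zeta> = E b1 \<mu> (\<zeta> + d) * E b1 \<mu> (\<zeta> - d)" for \<mu>
    unfolding E_def d_def by (rule tan_prod_bootstrap)
  have E_p: "E k l (\<zeta> + p) = inverse (E k l \<zeta>)" for k l \<zeta>
    unfolding E_def p_def by (rule tan_prod_shift_ipi)
  have E_nz: "\<forall>\<^sub>\<approx>\<zeta>\<in>UNIV. E k l (\<zeta> + c) \<noteq> 0" for k l c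
    unfolding E_def by (rule eventually_cosparse_shift[OF tan_prod_nonzero_cosparse])
  have boot_11: "\<forall>\<^sub>\<approx>\<zeta>\<in>UNIV. S b2 \<mu> \<zeta> = S b1 \<mu> (\<zeta> + d) * S b1 \<mu> (\<zeta> - d)" for \<mu>
    using boot[of \<mu>] SE[of b2 \<mu>] SE_shift[of b1 \<mu> d] SE_shift[of b1 \<mu> "- d"]
    by eventually_elim simp
  \<comment> \<open>The first fusion at \<open>\<zeta> - d\<close> gives a product of
    \<open>E b1 \<mu>\<close> at \<open>\<zeta>\<close> and at \<open>\<zeta> - d - d\<close>. By
    \<open>E_p\<close> the remaining factor, shifted further by p, is the inverse of the
    latter.\<close>
  have boot_12: "\<forall>\<^sub>\<approx>\<zeta>\<in>UNIV. S b1 \<mu> \<zeta> = S b1 \<mu> (\<zeta> + (p - d - d)) * S b2 \<mu> (\<zeta> - d)" for \<mu>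
    using eventually_cosparse_shift[OF boot[of \<mu>], of "- d"] SE[of b1 \<mu>]
      SE_shift[of b1 \<mu> "p - d - d"] SE_shift[of b2 \<mu> "- d"] E_nz[of b1 \<mu> "- d - d"]
  proof eventually_elim
    case (elim \<zeta>)
    then show ?case
      using E_p[of b1 \<mu> "\<zeta> - d - d"] by (simp add: algebra_simps)
  qed
  \<comment> \<open>The same argument at \<open>\<zeta> + d\<close>; now the factor at
    \<open>\<zeta> + d + d\<close> cancels.\<close>
  have boot_21: "\<forall>\<^sub>\<approx>\<zeta>\<in>UNIV. S b1 \<mu> \<zeta> = S b2 \<mu> (\<zeta> + d) * S b1 \<mu> (\<zeta> - (p - d - d))" for \<mu>
    using eventually_cosparse_shift[OF boot[of \<mu>], of d] SE[of b1 \<mu>]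
      SE_shift[of b1 \<mu> "- (p - d - d)"] SE_shift[of b2 \<mu> d] E_nz[of b1 \<mu> "- (p - d - d)"]
  proof eventually_elim
    case (elim \<zeta>)
    then show ?case
      using E_p[of b1 \<mu> "\<zeta> - (p - d - d)"] by (simp add: algebra_simps)
  qed
  have S6: "\<forall>(\<alpha>, \<beta>, \<gamma>) \<in> fusions. \<forall>\<mu>. \<forall>\<^sub>\<approx>\<zeta>\<in>UNIV.
      S \<gamma> \<mu> \<zeta> = S \<alpha> \<mu> (\<zeta> + \<i> * of_real (fusion_angle \<nu> \<gamma> \<alpha> \<beta>)) *
                S \<beta> \<mu> (\<zeta> - \<i> * of_real (fusion_angle \<nu> \<gamma> \<beta> \<alpha>))"
    using boot_11 boot_12 boot_21 unfolding fusions_def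
    by (simp only: ball_simps prod.case fusion_angle.simps angle flip: d_def) simp

  \<comment> \<open>Behaviour near the real axis and zeros in the strip\<close>
  have near_real: "\<exists>\<kappa>>0. \<exists>B. \<forall>\<zeta>. \<bar>Im \<zeta>\<bar> < \<kappa> \<longrightarrow> S k l \<zeta> = E k l \<zeta> \<and> cmod (S k l \<zeta>) \<le> B" for k l
  proof -
    obtain \<kappa> B where "\<kappa> > 0" and *: "\<And>\<zeta>. \<bar>Im \<zeta>\<bar> < \<kappa> \<Longrightarrow>
        regular_at (tan_params \<nu> \<nu>m k l) \<zeta> \<and> cmod (E k l \<zeta>) \<le> B"
      using tan_prod_bounded_near_real[of "tan_params \<nu> \<nu>m k l"] sin_tan_params_nonzero[OF bounds]
      unfolding E_def by metis
    have "S k l \<zeta> = E k l \<zeta>" if "\<bar>Im \<zeta>\<bar> < \<kappa>" for \<zeta>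
      using tan_prod_analytic *[OF that] by (simp add: S E_def)
    with * \<open>\<kappa> > 0\<close> show ?thesis
      by metis
  qed
  have S7: "S k k 0 = - 1" for k
  proof -
    have "regular_at (tan_params \<nu> \<nu>m k k) 0"
      using sin_tan_params_nonzero[OF bounds] by (auto simp: regular_at_def)
    \<comment> \<open>The parameter lists have lengths 3 and 7, both odd.\<close>
    then have "E k k 0 = - 1"
      unfolding E_def by (subst tan_prod_at_0) (cases k; simp)+
    moreover have "S k k 0 = E k k 0"
      using near_real[of k k] by auto
    ultimately show ?thesis
      by simp
  qed
  have S8: "finite (strip_zeros (S k l))" for k l
    unfolding S E_def by (rule finite_strip_zeros_tan_prod)
  have S8': "\<exists>\<kappa>>0. \<forall>k l. bdd_above {cmod (S k l \<zeta>) | \<zeta>. - \<kappa> < Im \<zeta> \<and> Im \<zeta> < \<kappa>}"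
  proof -
    obtain K B where K: "\<And>k l. K k l > 0"
      and B: "\<And>k l \<zeta>. \<bar>Im \<zeta>\<bar> < K k l \<Longrightarrow> cmod (S k l \<zeta>) \<le> B k l"
      using near_real by metis
    define \<kappa> where "\<kappa> = min (min (K b1 b1) (K b1 b2)) (min (K b2 b1) (K b2 b2))"
    have \<kappa>: "\<kappa> \<le> K k l" for k l
      unfolding \<kappa>_def by (cases k; cases l) auto
    have "bdd_above {cmod (S k l \<zeta>) | \<zeta>. - \<kappa> < Im \<zeta> \<and> Im \<zeta> < \<kappa>}" for k l
      using \<kappa>[of k l] B[of _ k l] by (intro bdd_aboveI[of _ "B k l"]) fastforce
    moreover have "\<kappa> > 0"
      using K by (simp add: \<kappa>_def)
    ultimately show ?thesis
      by blast
  qed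

  have sin_reflect: "sin (pi * (1 - a)) = sin (pi * a)" for a
    by (simp add: right_diff_distrib sin_diff)
  have sin_swap: "sin (pi * (a - b)) = - sin (pi * (b - a))" for a b
    by (simp flip: sin_minus add: right_diff_distrib)

  \<comment> \<open>Poles and residue of \<open>S b1 b1\<close>\<close>
  define s11 where "s11 = sin (pi * \<nu>)"
  \<comment> \<open>Here \<open>1 - \<nu> < \<nu> - \<nu>m\<close> follows from
    \<open>\<nu>m < 1 - \<nu>\<close> and \<nu> > 2/3.\<close>
  have s11_less: "s11 < sin (pi * (\<nu> - \<nu>m))" and s11_greater: "sin (pi * \<nu>m) < s11"
    using sin_pi_less[of "1 - \<nu>" "\<nu> - \<nu>m"] sin_pi_less[of \<nu>m \<nu>] bounds
    by (simp_all add: sin_reflect s11_def)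
  have "s11 > 0" "sin (pi * \<nu>m) > 0"
    using bounds by (auto simp: s11_def intro!: sin_pi_pos)
  have neg11: "\<forall>b\<in>set [\<nu>m - \<nu>, - \<nu>m]. sin (pi * b) < 0 \<and> - sin (pi * b) \<noteq> sin (pi * \<nu>)"
    using s11_less s11_greater \<open>s11 > 0\<close> \<open>sin (pi * \<nu>m) > 0\<close>
    by (auto simp: s11_def sin_swap[of \<nu>m \<nu>])
  have S11: "S b1 b1 = remove_sings (tan_prod (\<nu> # [\<nu>m - \<nu>, - \<nu>m]))"
    by (simp add: S E_def)
  have "0 < \<nu>" "\<nu> < 1" "\<nu> \<noteq> 1 / 2"
    using bounds by auto
  note poles11 = strip_poles_tan_prod[OF this neg11, folded S11]
  have S9a: "strip_poles (S b1 b1) = {\<i> * of_real (pi * \<nu>), \<i> * of_real (pi * (1 - \<nu>))}"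
    by (rule poles11(1))
  have S9b: "card (strip_poles (S b1 b1)) = 2"
    unfolding S9a using bounds by (simp add: complex_eq_iff)
  have S9c: "\<forall>\<zeta>\<in>strip_poles (S b1 b1). zorder (S b1 b1) \<zeta> = - 1"
    using poles11(2) by blast
  have S10a: "\<exists>r>0. residue (S b1 b1) (\<i> * of_real (pi * \<nu>)) = \<i> * of_real r"
  proof (intro exI conjI)
    \<comment> \<open>Exactly two terms are negative: the prefactor, as \<nu> > 1/2, and the ratio
      with \<open>\<nu> - \<nu>m\<close>.\<close>
    show "residue (S b1 b1) (\<i> * of_real (pi * \<nu>)) = \<i> * of_real (2 * s11 / cos (pi * \<nu>) *
        ((s11 - sin (pi * (\<nu> - \<nu>m))) / (s11 + sin (pi * (\<nu> - \<nu>m))) *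
         ((s11 - sin (pi * \<nu>m)) / (s11 + sin (pi * \<nu>m)))))"
      unfolding poles11(3) by (simp add: s11_def sin_swap[of \<nu>m \<nu>])
    have "cos (pi * \<nu>) < cos (pi / 2)"
      using bounds by (intro cos_monotone_0_pi) auto
    then have "2 * s11 / cos (pi * \<nu>) < 0"
      using \<open>s11 > 0\<close> by (intro divide_pos_neg) auto
    moreover have "(s11 - sin (pi * (\<nu> - \<nu>m))) / (s11 + sin (pi * (\<nu> - \<nu>m))) < 0"
      using s11_less \<open>s11 > 0\<close> by (intro divide_neg_pos) auto
    moreover have "(s11 - sin (pi * \<nu>m)) / (s11 + sin (pi * \<nu>m)) > 0"
      using s11_greater \<open>s11 > 0\<close> \<open>sin (pi * \<nu>m) > 0\<close> by (intro divide_pos_pos) auto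
    ultimately show "0 < 2 * s11 / cos (pi * \<nu>) *
        ((s11 - sin (pi * (\<nu> - \<nu>m))) / (s11 + sin (pi * (\<nu> - \<nu>m))) *
         ((s11 - sin (pi * \<nu>m)) / (s11 + sin (pi * \<nu>m))))"
      by (intro mult_neg_neg mult_neg_pos)
  qed

  \<comment> \<open>Poles and residue of \<open>S b1 b2\<close>\<close>
  define s12 where "s12 = sin (pi * (\<nu> / 2))"
  \<comment> \<open>Positivity of the reflected angle is the lower bound
    \<open>3 / 2 * \<nu> - 1 < \<nu>m\<close>.\<close>
  have "sin (pi * (1 - (3 * \<nu> / 2 - \<nu>m))) < s12"
    unfolding s12_def using bounds by (intro sin_pi_less) auto
  then have s12_greater: "sin (pi * (3 * \<nu> / 2 - \<nu>m)) < s12"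
    by (simp only: sin_reflect)
  have s12_greater': "sin (pi * (3 * \<nu> / 2 - 1)) < s12"
    unfolding s12_def using bounds by (intro sin_pi_less) auto
  have s12_less: "s12 < sin (pi * (\<nu> / 2 + \<nu>m))"
    unfolding s12_def using bounds by (intro sin_pi_less) auto
  have "s12 > 0" and sin_pos: "sin (pi * (3 * \<nu> / 2 - \<nu>m)) > 0" "sin (pi * (3 * \<nu> / 2 - 1)) > 0"
    unfolding s12_def using bounds by (intro sin_pi_pos; simp)+
  have sin12: "sin (pi * (3 * \<nu> / 2)) = - sin (pi * (3 * \<nu> / 2 - 1))"
    "sin (pi * (\<nu>m - 3 * \<nu> / 2)) = - sin (pi * (3 * \<nu> / 2 - \<nu>m))"
    "sin (pi * (- \<nu> / 2 - \<nu>m)) = - sin (pi * (\<nu> / 2 + \<nu>m))"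
    using sin_swap[of \<nu>m "3 * \<nu> / 2"] sin_swap[of "- \<nu> / 2" \<nu>m]
    by (simp_all add: right_diff_distrib sin_diff add.commute)
  have neg12: "\<forall>b\<in>set [3 * \<nu> / 2, \<nu>m - 3 * \<nu> / 2, - \<nu> / 2 - \<nu>m].
      sin (pi * b) < 0 \<and> - sin (pi * b) \<noteq> sin (pi * (\<nu> / 2))"
    using s12_greater s12_greater' s12_less \<open>s12 > 0\<close> sin_pos
    unfolding list.set ball_simps sin12 s12_def[symmetric] by simp
  have S12: "S b1 b2 = remove_sings (tan_prod (\<nu> / 2 # [3 * \<nu> / 2, \<nu>m - 3 * \<nu> / 2, - \<nu> / 2 - \<nu>m]))"
    by (simp add: S E_def)
  have "0 < \<nu> / 2" "\<nu> / 2 < 1" "\<nu> / 2 \<noteq> 1 / 2"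
    using bounds by auto
  note poles12 = strip_poles_tan_prod[OF this neg12, folded S12]
  have S9d: "strip_poles (S b1 b2) = {\<i> * of_real (pi * (1 - \<nu> / 2)), \<i> * of_real (pi * \<nu> / 2)}"
    unfolding poles12(1) times_divide_eq_right by (rule insert_commute)
  have S9e: "card (strip_poles (S b1 b2)) = 2"
    unfolding S9d using bounds by (simp add: complex_eq_iff)
  have S9f: "\<forall>\<zeta>\<in>strip_poles (S b1 b2). zorder (S b1 b2) \<zeta> = - 1"
    using poles12(2) by blast
  have S10b: "\<exists>r>0. residue (S b1 b2) (\<i> * of_real (pi * (1 - \<nu> / 2))) = \<i> * of_real r"
  proof (intro exI conjI)
    \<comment> \<open>At the reflected pole the prefactor carries a minus sign while the cosine is
      positive. The ratio with \<open>\<nu> / 2 + \<nu>m\<close> is the only other negative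
      term.\<close>
    show "residue (S b1 b2) (\<i> * of_real (pi * (1 - \<nu> / 2))) = \<i> * of_real (- 2 * s12 / cos (pi * (\<nu> / 2)) *
        ((s12 - sin (pi * (\<nu> / 2 + \<nu>m))) / (s12 + sin (pi * (\<nu> / 2 + \<nu>m))) *
         ((s12 - sin (pi * (3 * \<nu> / 2 - 1))) / (s12 + sin (pi * (3 * \<nu> / 2 - 1))) *
          ((s12 - sin (pi * (3 * \<nu> / 2 - \<nu>m))) / (s12 + sin (pi * (3 * \<nu> / 2 - \<nu>m)))))))"
      unfolding poles12(4) list.map prod_list.Cons prod_list.Nil sin12 s12_def[symmetric]
      by (simp add: mult_ac)
    have "cos (pi * (\<nu> / 2)) > 0"
      using bounds by (intro cos_gt_zero_pi) (auto intro: less_trans[of _ 0])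
    then have "- 2 * s12 / cos (pi * (\<nu> / 2)) < 0"
      using \<open>s12 > 0\<close> by (intro divide_neg_pos) auto
    moreover have "(s12 - sin (pi * (\<nu> / 2 + \<nu>m))) / (s12 + sin (pi * (\<nu> / 2 + \<nu>m))) < 0"
      using s12_less \<open>s12 > 0\<close> by (intro divide_neg_pos) auto
    moreover have "(s12 - sin (pi * (3 * \<nu> / 2 - 1))) / (s12 + sin (pi * (3 * \<nu> / 2 - 1))) > 0"
      using s12_greater' \<open>s12 > 0\<close> sin_pos by (intro divide_pos_pos) auto
    moreover have "(s12 - sin (pi * (3 * \<nu> / 2 - \<nu>m))) / (s12 + sin (pi * (3 * \<nu> / 2 - \<nu>m))) > 0"
      using s12_greater \<open>s12 > 0\<close> sin_pos by (intro divide_pos_pos) auto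
    ultimately show "0 < - 2 * s12 / cos (pi * (\<nu> / 2)) *
        ((s12 - sin (pi * (\<nu> / 2 + \<nu>m))) / (s12 + sin (pi * (\<nu> / 2 + \<nu>m))) *
         ((s12 - sin (pi * (3 * \<nu> / 2 - 1))) / (s12 + sin (pi * (3 * \<nu> / 2 - 1))) *
          ((s12 - sin (pi * (3 * \<nu> / 2 - \<nu>m))) / (s12 + sin (pi * (3 * \<nu> / 2 - \<nu>m))))))"
      by (intro mult_neg_neg mult_neg_pos mult_pos_pos)
  qed

  show ?case
    unfolding S_def[symmetric] Let_def
    using S1 S2 S3 S4 S5 S6 S7 S8 S8' S9a S9b S9c S9d S9e S9f S10a S10b by blast
qed

end
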